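(* Let $P$ be a connected polymatroid on a finite set $E$ with rank function $f$. For any $e\in E$ and any $j\in T_e$ satisfying $j\ge \alpha_e+1$, where $\alpha_e=f(E)-f(E-e)$ and $T_e=\{\alpha_e,\alpha_e+1,\ldots,f(\{e\})\}$, at least one of the slice-projections $\widehat{P}^{e}_{j}$ and $\widehat{P}^{e}_{j-1}$ is connected.
   Context: Let $E$ be a finite set (without loss of generality $E=[n]=\{1,\ldots,n\}$). Single elements are identified with singletons: $f(e)=f(\{e\})$, $E-e=E\setminus\{e\}$, $I\cup e=I\cup\{e\}$; and $E-I=E\setminus I$. Rank function. A function $f:2^E\to\mathbb{Z}_{\ge 0}$ is a rank function if (i) $f(\emptyset)=0$; (ii) $f(I)\le f(J)$ for all $I\subseteq J\subseteq E$; (iii) $f(I)+f(J)\ge f(I\cup J)+f(I\cap J)$ for all $I,J\subseteq E$. Polymatroid. The polymatroid $P$ on $E$ with rank function $f$ is $P=\{(a_i)_{i\in E}\in\mathbb{Z}_{\ge 0}^{E} : \sum_{i\in I}a_i\le f(I)\text{ for all } I\subseteq E\}$, and its set of bases is $B_P=\{\mathbf{a}\in P : \sum_{i\in E}a_i=f(E)\}$. The set of bases determines the polymatroid and its rank function, via $f(I)=\max_{\mathbf{a}\in B_P}\sum_{i\in I}a_i$. Connectedness. A polymatroid on $E$ with rank function $f$ is connected if $f(I)+f(E-I)>f(E)$ for all nonempty proper subsets $I$ of $E$; otherwise it is disconnected. Slice-projection. For $e\in E$ put $\alpha_e=f(E)-f(E-e)$, $\beta_e=f(\{e\})$, $T_e=\{\alpha_e,\alpha_e+1,\ldots,\beta_e\}$.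 For $j\in T_e$, let $B_{\widehat{P}^e_j}\subseteq\mathbb{Z}_{\ge0}^{E-e}$ be the set of vectors obtained by deleting the $e$-th coordinate from those bases $\mathbf{a}\in B_P$ with $a_e=j$. It is known that $B_{\widehat{P}^e_j}$ is the set of bases of a polymatroid on $E-e$; this polymatroid is denoted $\widehat{P}^e_j$ and called a slice-projection of $P$. *)

theory Defs
  imports Main "HOL-Library.FuncSet"
begin

text \<open>
  The ground set is an explicit carrier \<^term>\<open>E :: 'a set\<close>, assumed finite where needed.
  A rank function is a function on all of \<^typ>\<open>'a set\<close> of which only the values on subsets
  of \<^term>\<open>E\<close> matter.
\<close>

definition rank_function :: "'a set \<Rightarrow> ('a set \<Rightarrow> nat) \<Rightarrow> bool" where
  "rank_function E f \<longleftrightarrow>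
     f {} = 0 \<and>
     (\<forall>I J. I \<subseteq> J \<and> J \<subseteq> E \<longrightarrow> f I \<le> f J) \<and>
     (\<forall>I J. I \<subseteq> E \<and> J \<subseteq> E \<longrightarrow> f I + f J \<ge> f (I \<union> J) + f (I \<inter> J))"

text \<open>Vectors indexed by \<^term>\<open>E\<close> are extensional functions on \<^term>\<open>E\<close>.\<close>

definition polymatroid :: "'a set \<Rightarrow> ('a set \<Rightarrow> nat) \<Rightarrow> ('a \<Rightarrow> nat) set" where
  "polymatroid E f = {a \<in> E \<rightarrow>\<^sub>E UNIV. \<forall>I. I \<subseteq> E \<longrightarrow> (\<Sum>i\<in>I. a i) \<le> f I}"

definition bases :: "'a set \<Rightarrow> ('a set \<Rightarrow> nat) \<Rightarrow> ('a \<Rightarrow> nat) set" where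
  "bases E f = {a \<in> polymatroid E f. (\<Sum>i\<in>E. a i) = f E}"

text \<open>
  A set of bases determines its polymatroid through the rank function below. The maximum is
  meaningful for finite nonempty \<^term>\<open>B\<close>, which the set of bases of a polymatroid on a finite
  set always is.
\<close>

definition rank_of_bases :: "('a \<Rightarrow> nat) set \<Rightarrow> 'a set \<Rightarrow> nat" where
  "rank_of_bases B I = Max ((\<lambda>a. \<Sum>i\<in>I. a i) ` B)"

text \<open>Connectedness of the polymatroid on \<^term>\<open>E\<close> with rank function \<^term>\<open>f\<close>.\<close>

definition connected_polymatroid :: "'a set \<Rightarrow> ('a set \<Rightarrow> nat) \<Rightarrow> bool" where
  "connected_polymatroid E f \<longleftrightarrow>
     (\<forall>I. I \<noteq> {} \<and> I \<subset> E \<longrightarrow> f I + f (E - I) > f E)"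

text \<open>The subtraction does not truncate when \<^term>\<open>f\<close> is a rank function on \<^term>\<open>E\<close>.\<close>

definition alpha :: "'a set \<Rightarrow> ('a set \<Rightarrow> nat) \<Rightarrow> 'a \<Rightarrow> nat" where
  "alpha E f e = f E - f (E - {e})"

definition slice_range :: "'a set \<Rightarrow> ('a set \<Rightarrow> nat) \<Rightarrow> 'a \<Rightarrow> nat set" where
  "slice_range E f e = {alpha E f e..f {e}}"

definition slice_bases :: "'a set \<Rightarrow> ('a set \<Rightarrow> nat) \<Rightarrow> 'a \<Rightarrow> nat \<Rightarrow> ('a \<Rightarrow> nat) set" where
  "slice_bases E f e j = (\<lambda>a. restrict a (E - {e})) ` {a \<in> bases E f. a e = j}"

text \<open>
  For \<^term>\<open>j \<in> slice_range E f e\<close>, the slice-projection is the polymatroid on \<^term>\<open>E - {e}\<close>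
  whose set of bases is \<^term>\<open>slice_bases E f e j\<close>; like every polymatroid here it is given by
  its rank function.
\<close>

definition slice_projection_rank ::
    "'a set \<Rightarrow> ('a set \<Rightarrow> nat) \<Rightarrow> 'a \<Rightarrow> nat \<Rightarrow> 'a set \<Rightarrow> nat" where
  "slice_projection_rank E f e j = rank_of_bases (slice_bases E f e j)"

end

theory Submission
  imports Defs
begin

text \<open>
  Write \<open>\<alpha> = alpha E f e\<close> and \<open>\<beta> = f {e}\<close>. The proof rests on an explicit formula for the
  rank of a slice, \<open>min (f (I \<union> e) - j) (f I)\<close> (lemma \<open>slice_projection_rank_eq\<close>). Suppose the
  slice at \<open>j\<close> splits along a partition of \<open>E - e\<close> into nonempty parts \<open>I\<close> and \<open>J\<close>, and expand the
  two minima. If they were attained on different sides, then \<open>I\<close> and \<open>J \<union> e\<close>, or \<open>I \<union> e\<close> and \<open>J\<close>,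
  would already split the connected polymatroid. If both are attained at \<open>f\<close>, then
  \<open>f I + f J = f E - j\<close>, and as \<open>f I + f J \<ge> f (E - e) = f E - \<alpha>\<close> this forces \<open>j = \<alpha>\<close>. If both
  are attained at \<open>f (_ \<union> e) - j\<close>, then \<open>f (I \<union> e) + f (J \<union> e) = f E + j\<close>, and submodularity
  forces \<open>j = \<beta>\<close>. So only the two extreme slices can be disconnected
  (lemma \<open>disconnected_slice_partition\<close>).

  Two consecutive disconnected slices are therefore the slices at \<open>\<alpha>\<close> and at \<open>\<beta> = \<alpha> + 1\<close>. They
  yield partitions \<open>{I, J}\<close> and \<open>{K, L}\<close> of \<open>E - e\<close> with
  \<open>f I + f J + f (K \<union> e) + f (L \<union> e) = 2 * f E + 1\<close>. Uncrossing \<open>I\<close> with \<open>K \<union> e\<close> and \<open>J\<close> with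
  \<open>L \<union> e\<close> turns the left-hand side into two complementary pairs, so that connectedness would give
  at least \<open>2 * f E + 2\<close> if \<open>I \<inter> K\<close> and \<open>J \<inter> L\<close> were both nonempty (lemma
  \<open>uncrossing_partitions\<close>). Hence one of these intersections is empty, and likewise one of
  \<open>I \<inter> L\<close> and \<open>J \<inter> K\<close>; each combination leaves one of the four parts empty.
\<close>

section \<open>Rank functions and the greedy construction of bases\<close>

lemma rank_function_empty: "rank_function E f \<Longrightarrow> f {} = 0"
  by (simp add: rank_function_def)

lemma rank_function_mono: "rank_function E f \<Longrightarrow> I \<subseteq> J \<Longrightarrow> J \<subseteq> E \<Longrightarrow> f I \<le> f J"
  by (simp add: rank_function_def)

lemma rank_function_submodular:
  "rank_function E f \<Longrightarrow> I \<subseteq> E \<Longrightarrow> J \<subseteq> E \<Longrightarrow> f (I \<union> J) + f (I \<inter> J) \<le> f I + f J"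
  by (simp add: rank_function_def)

lemma bases_sum_le: "a \<in> bases E f \<Longrightarrow> I \<subseteq> E \<Longrightarrow> (\<Sum>i\<in>I. a i) \<le> f I"
  by (simp add: bases_def polymatroid_def)

lemma bases_sum_eq: "a \<in> bases E f \<Longrightarrow> (\<Sum>i\<in>E. a i) = f E"
  by (simp add: bases_def)

lemma finite_bases:
  assumes "finite E"
  shows "finite (bases E f)"
proof (rule finite_subset)
  show "bases E f \<subseteq> (\<Pi>\<^sub>E i\<in>E. {..f {i}})"
  proof
    fix a assume a: "a \<in> bases E f"
    have "a i \<le> f {i}" if "i \<in> E" for i
      using bases_sum_le[OF a, of "{i}"] that by simp
    then show "a \<in> (\<Pi>\<^sub>E i\<in>E. {..f {i}})"
      using a by (auto simp: bases_def polymatroid_def PiE_iff)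
  qed
qed (use assms in \<open>simp add: finite_PiE\<close>)

text \<open>
  One step of the greedy algorithm: the new coordinate is the marginal rank of \<open>x\<close> over \<open>S\<close>.
  Marginal ranks only grow when \<open>S\<close> is replaced by a subset, so no constraint is violated.
\<close>

lemma bases_extend_insert:
  assumes f: "rank_function E f" and fin: "finite S" and sub: "insert x S \<subseteq> E"
    and x: "x \<notin> S" and a: "a \<in> bases S f"
  shows "a(x := f (insert x S) - f S) \<in> bases (insert x S) f"
proof -
  define b where "b = a(x := f (insert x S) - f S)"
  have mono: "f S \<le> f (insert x S)"
    using rank_function_mono[OF f, of S "insert x S"] sub by blast
  have agree: "(\<Sum>i\<in>K. b i) = (\<Sum>i\<in>K. a i)" if "x \<notin> K" for K
    using that by (intro sum.cong) (auto simp: b_def)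
  have "(\<Sum>i\<in>K. b i) \<le> f K" if K: "K \<subseteq> insert x S" for K
  proof (cases "x \<in> K")
    case False
    then show ?thesis using agree bases_sum_le[OF a, of K] K by auto
  next
    case True
    have "finite K" using K fin by (metis finite_insert finite_subset)
    then have "(\<Sum>i\<in>K. b i) = b x + (\<Sum>i\<in>K - {x}. b i)"
      using True by (rule sum.remove)
    also have "\<dots> = f (insert x S) - f S + (\<Sum>i\<in>K - {x}. a i)"
      using agree[of "K - {x}"] by (simp add: b_def)
    also have "\<dots> \<le> f (insert x S) - f S + f (K - {x})"
      using bases_sum_le[OF a, of "K - {x}"] K by auto
    also have "\<dots> \<le> f K"
    proof -
      have "K \<union> S = insert x S" "K \<inter> S = K - {x}" using K True x by auto
      moreover have "f (K \<union> S) + f (K \<inter> S) \<le> f K + f S"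
        using K sub by (intro rank_function_submodular[OF f]) auto
      ultimately show ?thesis using mono by simp
    qed
    finally show ?thesis .
  qed
  moreover have "b \<in> insert x S \<rightarrow>\<^sub>E UNIV"
    using a by (auto simp: b_def bases_def polymatroid_def PiE_iff extensional_def)
  moreover have "(\<Sum>i\<in>insert x S. b i) = f (insert x S)"
    using fin x agree[OF x] bases_sum_eq[OF a] mono by (simp add: b_def)
  ultimately show ?thesis by (simp add: bases_def polymatroid_def b_def)
qed

lemma bases_extend:
  assumes f: "rank_function E f" and fin: "finite T" and sub: "S \<subseteq> T" "T \<subseteq> E"
    and a: "a \<in> bases S f"
  shows "\<exists>b \<in> bases T f. \<forall>i\<in>S. b i = a i"
proof -
  have "U \<subseteq> T - S \<Longrightarrow> \<exists>b \<in> bases (S \<union> U) f. \<forall>i\<in>S. b i = a i" if "finite U" for U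
    using that
  proof (induction U rule: finite_induct)
    case empty
    then show ?case using a by auto
  next
    case (insert x U)
    then obtain b where b: "b \<in> bases (S \<union> U) f" "\<forall>i\<in>S. b i = a i" by auto
    have "finite (S \<union> U)" using fin sub insert.hyps finite_subset by auto
    moreover have "insert x (S \<union> U) \<subseteq> E" "x \<notin> S \<union> U" using insert sub by auto
    ultimately have "b(x := f (insert x (S \<union> U)) - f (S \<union> U)) \<in> bases (insert x (S \<union> U)) f"
      using bases_extend_insert[OF f _ _ _ b(1)] by blast
    moreover have "\<forall>i\<in>S. (b(x := f (insert x (S \<union> U)) - f (S \<union> U))) i = a i"
      using b(2) insert.prems by auto
    ultimately show ?case by (metis Un_insert_right)
  qed
  from this[of "T - S"] have "\<exists>b \<in> bases (S \<union> (T - S)) f. \<forall>i\<in>S. b i = a i"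
    using fin by auto
  moreover have "S \<union> (T - S) = T" using sub by auto
  ultimately show ?thesis by simp
qed

text \<open>Running the greedy algorithm along \<open>S \<subseteq> T \<subseteq> E\<close> makes both constraints tight at once.\<close>

lemma exists_base_tight_on_chain:
  assumes f: "rank_function E f" and fin: "finite E" and sub: "S \<subseteq> T" "T \<subseteq> E"
  obtains b where "b \<in> bases E f" "(\<Sum>i\<in>S. b i) = f S" "(\<Sum>i\<in>T. b i) = f T"
proof -
  have finT: "finite T" using sub(2) fin by (rule finite_subset)
  have finS: "finite S" using sub(1) finT by (rule finite_subset)
  have "(\<lambda>_. undefined) \<in> bases {} f"
    using rank_function_empty[OF f] by (simp add: bases_def polymatroid_def)
  then obtain a where a: "a \<in> bases S f"
    using bases_extend[OF f finS empty_subsetI subset_trans[OF sub]] by blast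
  obtain c where c: "c \<in> bases T f" "\<forall>i\<in>S. c i = a i"
    using bases_extend[OF f finT sub a] by blast
  obtain b where b: "b \<in> bases E f" "\<forall>i\<in>T. b i = c i"
    using bases_extend[OF f fin sub(2) subset_refl c(1)] by blast
  have "(\<Sum>i\<in>S. b i) = (\<Sum>i\<in>S. a i)"
    using b c sub by (intro sum.cong) auto
  moreover have "(\<Sum>i\<in>T. b i) = (\<Sum>i\<in>T. c i)"
    using b by (intro sum.cong) auto
  ultimately show thesis
    using that b(1) bases_sum_eq[OF a] bases_sum_eq[OF c(1)] by simp
qed

section \<open>The rank of a slice-projection\<close>

text \<open>
  The rank function of the polymatroid obtained by imposing the additional constraint
  \<open>a e \<le> j\<close>.
\<close>

definition truncated_rank :: "('a set \<Rightarrow> nat) \<Rightarrow> 'a \<Rightarrow> nat \<Rightarrow> 'a set \<Rightarrow> nat" where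
  "truncated_rank f e j S = (if e \<in> S then min (f S) (f (S - {e}) + j) else f S)"

lemma truncated_rank_le: "truncated_rank f e j S \<le> f S"
  by (simp add: truncated_rank_def)

text \<open>
  Each value is the minimum of \<open>f\<close> on \<open>S\<close> and of \<open>f\<close> on \<open>S - {e}\<close> plus the price \<open>j\<close> for dropping
  \<open>e\<close>. Take the sets attaining the minima for \<open>I\<close> and \<open>J\<close>: their union and intersection are
  candidates for \<open>I \<union> J\<close> and \<open>I \<inter> J\<close> at no higher total price. The four inequalities in the
  proof are the four ways of choosing these sets.
\<close>

lemma rank_function_truncated_rank:
  assumes f: "rank_function E f"
  shows "rank_function E (truncated_rank f e j)"
  unfolding rank_function_def
proof (intro conjI allI impI)
  show "truncated_rank f e j {} = 0"
    using rank_function_empty[OF f] by (simp add: truncated_rank_def)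
next
  fix I J assume IJ: "I \<subseteq> J \<and> J \<subseteq> E"
  then have "f I \<le> f J" "f (I - {e}) \<le> f (J - {e})" "e \<notin> I \<Longrightarrow> f I \<le> f (J - {e})"
    by (intro rank_function_mono[OF f]; blast)+
  then show "truncated_rank f e j I \<le> truncated_rank f e j J"
    using IJ by (auto simp: truncated_rank_def)
next
  fix I J assume IJ: "I \<subseteq> E \<and> J \<subseteq> E"
  note sub = rank_function_submodular[OF f]
  have both: "f (I \<union> J) + f (I \<inter> J) \<le> f I + f J"
    using sub IJ by blast
  have none: "f ((I \<union> J) - {e}) + f ((I \<inter> J) - {e}) \<le> f (I - {e}) + f (J - {e})"
  proof -
    have "(I \<union> J) - {e} = (I - {e}) \<union> (J - {e})" "(I \<inter> J) - {e} = (I - {e}) \<inter> (J - {e})"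
      by auto
    then show ?thesis using sub[of "I - {e}" "J - {e}"] IJ by auto
  qed
  have left: "f (I \<union> J) + f ((I \<inter> J) - {e}) \<le> f I + f (J - {e})" if "e \<in> I"
  proof -
    have "I \<union> J = I \<union> (J - {e})" "(I \<inter> J) - {e} = I \<inter> (J - {e})" using that by auto
    then show ?thesis using sub[of I "J - {e}"] IJ by auto
  qed
  have right: "f (I \<union> J) + f ((I \<inter> J) - {e}) \<le> f (I - {e}) + f J" if "e \<in> J"
  proof -
    have "I \<union> J = (I - {e}) \<union> J" "(I \<inter> J) - {e} = (I - {e}) \<inter> J" using that by auto
    then show ?thesis using sub[of "I - {e}" J] IJ by auto
  qed
  show "truncated_rank f e j (I \<union> J) + truncated_rank f e j (I \<inter> J)
      \<le> truncated_rank f e j I + truncated_rank f e j J"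
  proof (cases "e \<in> I"; cases "e \<in> J")
    assume "e \<in> I" "e \<in> J"
    then show ?thesis using both none left right by (auto simp: truncated_rank_def min_def)
  next
    assume "e \<in> I" "e \<notin> J"
    then show ?thesis using both none by (auto simp: truncated_rank_def min_def)
  next
    assume "e \<notin> I" "e \<in> J"
    then show ?thesis using both none by (auto simp: truncated_rank_def min_def)
  next
    assume "e \<notin> I" "e \<notin> J"
    then show ?thesis using both by (auto simp: truncated_rank_def)
  qed
qed

lemma alpha_add:
  assumes "rank_function E f"
  shows "alpha E f e + f (E - {e}) = f E"
  using rank_function_mono[OF assms, of "E - {e}" E] by (auto simp: alpha_def)

text \<open>
  Every base with \<open>a e = j\<close> obeys the bounds \<open>f I\<close> and \<open>f (insert e I) - j\<close> on \<open>I\<close>. The smaller one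
  is attained: a base of the truncated polymatroid that is tight on \<open>{e}\<close> and on \<open>insert e I\<close> has
  \<open>e\<close>-coordinate \<open>j\<close> because \<open>j \<le> f {e}\<close>, and it is a base of the original polymatroid because
  \<open>j \<ge> alpha E f e\<close> leaves the rank of \<open>E\<close> unchanged.
\<close>

lemma slice_projection_rank_eq:
  assumes fin: "finite E" and f: "rank_function E f" and e: "e \<in> E"
    and j: "j \<in> slice_range E f e" and I: "I \<subseteq> E - {e}"
  shows "slice_projection_rank E f e j I + j = min (f (insert e I)) (f I + j)"
proof -
  let ?h = "truncated_rank f e j"
  let ?B = "slice_bases E f e j"
  have eI: "e \<notin> I" "insert e I \<subseteq> E" "I \<subseteq> E" using I e by auto
  have finI: "finite I" using eI(3) fin by (rule finite_subset)
  have j': "j \<le> f {e}" "alpha E f e \<le> j" using j by (auto simp: slice_range_def)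
  have restr: "(\<Sum>i\<in>I. restrict a (E - {e}) i) = (\<Sum>i\<in>I. a i)" for a :: "'a \<Rightarrow> nat"
    using I by (intro sum.cong) auto
  have split: "(\<Sum>i\<in>insert e I. a i) = a e + (\<Sum>i\<in>I. a i)" for a :: "'a \<Rightarrow> nat"
    using finI eI by simp
  obtain b where b: "b \<in> bases E ?h" "(\<Sum>i\<in>{e}. b i) = ?h {e}"
      "(\<Sum>i\<in>insert e I. b i) = ?h (insert e I)"
    using eI by (elim exists_base_tight_on_chain
      [OF rank_function_truncated_rank[OF f] fin, of "{e}" "insert e I", rotated 2]) auto
  have be: "b e = j"
    using b(2) j' rank_function_empty[OF f] by (simp add: truncated_rank_def)
  have hE: "?h E = f E"
    using alpha_add[OF f, of e] j' e by (simp add: truncated_rank_def)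
  have "b \<in> bases E f"
    using b(1) hE truncated_rank_le[of f e j] unfolding bases_def polymatroid_def
    by (auto intro: order_trans)
  then have bB: "restrict b (E - {e}) \<in> ?B"
    using be by (auto simp: slice_bases_def)
  have bI: "(\<Sum>i\<in>I. b i) + j = min (f (insert e I)) (f I + j)"
    using b(3) split[of b] be eI by (simp add: truncated_rank_def)
  have "rank_of_bases ?B I = (\<Sum>i\<in>I. b i)"
    unfolding rank_of_bases_def
  proof (rule Max_eqI)
    show "finite ((\<lambda>a. \<Sum>i\<in>I. a i) ` ?B)"
      using finite_bases[OF fin] by (simp add: slice_bases_def)
  next
    show "(\<Sum>i\<in>I. b i) \<in> (\<lambda>a. \<Sum>i\<in>I. a i) ` ?B"
      using bB restr[of b] by (metis image_eqI)
  next
    fix s assume "s \<in> (\<lambda>a. \<Sum>i\<in>I. a i) ` ?B"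
    then obtain a where a: "a \<in> bases E f" "a e = j" "s = (\<Sum>i\<in>I. a i)"
      using restr by (auto simp: slice_bases_def)
    have "s \<le> f I" using a bases_sum_le eI by blast
    moreover have "j + s \<le> f (insert e I)"
      using bases_sum_le[OF a(1) eI(2)] split[of a] a by simp
    ultimately show "s \<le> (\<Sum>i\<in>I. b i)" using bI by linarith
  qed
  then show ?thesis using bI by (simp add: slice_projection_rank_def)
qed

section \<open>Disconnected slices of a connected polymatroid\<close>

lemma connected_polymatroid_sum_gt:
  assumes "connected_polymatroid E f" "I \<union> J = E" "I \<inter> J = {}" "I \<noteq> {}" "J \<noteq> {}"
  shows "f E < f I + f J"
proof -
  have J: "J = E - I" and I: "I \<noteq> {} \<and> I \<subset> E" using assms(2-) by blast+
  have "f E < f I + f (E - I)"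
    using assms(1) I unfolding connected_polymatroid_def by blast
  then show ?thesis unfolding J .
qed

text \<open>
  Only the two extreme slices can be disconnected. The two alternatives record at which end the
  slice lies and which of the two bounds on the slice rank is attained on both parts.
\<close>

lemma disconnected_slice_partition:
  assumes fin: "finite E" and f: "rank_function E f" and conn: "connected_polymatroid E f"
    and e: "e \<in> E" and j: "j \<in> slice_range E f e"
    and disc: "\<not> connected_polymatroid (E - {e}) (slice_projection_rank E f e j)"
  obtains I J where "I \<union> J = E - {e}" "I \<inter> J = {}" "I \<noteq> {}" "J \<noteq> {}"
    "j = alpha E f e \<and> f I + f J + j = f E \<or>
     j = f {e} \<and> f (insert e I) + f (insert e J) = f E + j"
proof -
  let ?r = "slice_projection_rank E f e j"
  have j': "j \<le> f {e}" "alpha E f e \<le> j" using j by (auto simp: slice_range_def)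
  obtain I where I: "I \<noteq> {}" "I \<subset> E - {e}" "?r I + ?r (E - {e} - I) \<le> ?r (E - {e})"
    using disc unfolding connected_polymatroid_def by (meson leI)
  define J where "J = E - {e} - I"
  have part: "I \<union> J = E - {e}" "I \<inter> J = {}" "I \<noteq> {}" "J \<noteq> {}"
    using I by (auto simp: J_def)
  have sub: "I \<subseteq> E - {e}" "J \<subseteq> E - {e}" using part(1) by blast+
  then have subE: "I \<subseteq> E" "J \<subseteq> E" "insert e I \<subseteq> E" "insert e J \<subseteq> E" using e by blast+
  note rank = slice_projection_rank_eq[OF fin f e j]
  have rI: "?r I + j = min (f (insert e I)) (f I + j)"
    and rJ: "?r J + j = min (f (insert e J)) (f J + j)"
    using rank sub by auto
  have "?r (E - {e}) + j = min (f (insert e (E - {e}))) (f (E - {e}) + j)"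
    using rank by blast
  then have rE: "?r (E - {e}) + j = f E"
    using e alpha_add[OF f, of e] j' by (simp add: insert_absorb)
  have "f E < f (insert e I) + f J"
    using part e by (intro connected_polymatroid_sum_gt[OF conn]) auto
  moreover have "f E < f I + f (insert e J)"
    using part e by (intro connected_polymatroid_sum_gt[OF conn]) auto
  moreover have "f (E - {e}) \<le> f I + f J"
    using rank_function_submodular[OF f subE(1,2)] part by simp
  moreover have "f E + f {e} \<le> f (insert e I) + f (insert e J)"
  proof -
    have "insert e I \<union> insert e J = E" "insert e I \<inter> insert e J = {e}" using part e by auto
    then show ?thesis
      using rank_function_submodular[OF f subE(3,4)] by (simp only:)
  qed
  moreover have "?r I + ?r J \<le> ?r (E - {e})" using I by (simp add: J_def)
  ultimately have "j = alpha E f e \<and> f I + f J + j = f E \<or>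
     j = f {e} \<and> f (insert e I) + f (insert e J) = f E + j"
    using rI rJ rE j' alpha_add[OF f, of e] by (auto simp: min_def split: if_splits)
  then show thesis using that part by blast
qed

text \<open>
  After uncrossing \<open>I\<close> with \<open>insert e K\<close> and \<open>J\<close> with \<open>insert e L\<close>, the complement of \<open>I \<inter> K\<close> is
  \<open>J \<union> insert e L\<close>, and the complement of \<open>J \<inter> L\<close> is \<open>I \<union> insert e K\<close>; connectedness gains one
  for each pair.
\<close>

lemma uncrossing_partitions:
  assumes f: "rank_function E f" and conn: "connected_polymatroid E f" and e: "e \<in> E"
    and IJ: "I \<union> J = E - {e}" "I \<inter> J = {}" and KL: "K \<union> L = E - {e}" "K \<inter> L = {}"
    and ne: "I \<inter> K \<noteq> {}" "J \<inter> L \<noteq> {}"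
  shows "2 * f E + 2 \<le> f I + f J + f (insert e K) + f (insert e L)"
proof -
  have sub: "I \<subseteq> E" "J \<subseteq> E" "insert e K \<subseteq> E" "insert e L \<subseteq> E" using IJ KL e by auto
  have "I \<inter> insert e K = I \<inter> K" "J \<inter> insert e L = J \<inter> L" using IJ by auto
  then have "f (I \<union> insert e K) + f (I \<inter> K) \<le> f I + f (insert e K)"
    and "f (J \<union> insert e L) + f (J \<inter> L) \<le> f J + f (insert e L)"
    using rank_function_submodular[OF f] sub by metis+
  moreover have "f E < f (I \<inter> K) + f (J \<union> insert e L)"
    using IJ KL e ne by (intro connected_polymatroid_sum_gt[OF conn]) blast+
  moreover have "f E < f (J \<inter> L) + f (I \<union> insert e K)"
    using IJ KL e ne by (intro connected_polymatroid_sum_gt[OF conn]) blast+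
  ultimately show ?thesis by linarith
qed

theorem theorem1p7:
  fixes E :: "'a set" and f :: "'a set \<Rightarrow> nat" and e :: 'a and j :: nat
  assumes "finite E"
    and "rank_function E f"
    and "connected_polymatroid E f"
    and "e \<in> E"
    and "j \<in> slice_range E f e"
    and "j \<ge> alpha E f e + 1"
  shows "connected_polymatroid (E - {e}) (slice_projection_rank E f e j) \<or>
         connected_polymatroid (E - {e}) (slice_projection_rank E f e (j - 1))"
proof (rule ccontr)
  assume "\<not> ?thesis"
  then have disc: "\<not> connected_polymatroid (E - {e}) (slice_projection_rank E f e j)"
      "\<not> connected_polymatroid (E - {e}) (slice_projection_rank E f e (j - 1))" by auto
  have range: "j - 1 \<in> slice_range E f e" "j \<le> f {e}"
    using assms(5,6) by (auto simp: slice_range_def)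
  obtain I J where IJ: "I \<union> J = E - {e}" "I \<inter> J = {}" "I \<noteq> {}" "J \<noteq> {}"
    and IJ_alt: "j - 1 = alpha E f e \<and> f I + f J + (j - 1) = f E \<or>
      j - 1 = f {e} \<and> f (insert e I) + f (insert e J) = f E + (j - 1)"
    by (rule disconnected_slice_partition[OF assms(1-4) range(1) disc(2)])
  obtain K L where KL: "K \<union> L = E - {e}" "K \<inter> L = {}" "K \<noteq> {}" "L \<noteq> {}"
    and KL_alt: "j = alpha E f e \<and> f K + f L + j = f E \<or>
      j = f {e} \<and> f (insert e K) + f (insert e L) = f E + j"
    by (rule disconnected_slice_partition[OF assms(1-5) disc(1)])
  \<comment> \<open>As \<open>alpha E f e \<le> j - 1 < j \<le> f {e}\<close>, the slice at \<open>j\<close> must be the top one and the slice at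
    \<open>j - 1\<close> the bottom one.\<close>
  have total: "f I + f J + f (insert e K) + f (insert e L) = 2 * f E + 1"
    using IJ_alt KL_alt range assms(6) by auto
  have "I \<inter> K = {} \<or> J \<inter> L = {}"
    using uncrossing_partitions[OF assms(2-4) IJ(1,2) KL(1,2)] total by linarith
  moreover have "I \<inter> L = {} \<or> J \<inter> K = {}"
  proof -
    have LK: "L \<union> K = E - {e}" "L \<inter> K = {}" using KL(1,2) by blast+
    show ?thesis
      using uncrossing_partitions[OF assms(2-4) IJ(1,2) LK] total by linarith
  qed
  moreover have "I \<union> J = K \<union> L" using IJ(1) KL(1) by simp
  ultimately show False using IJ(3,4) KL(3,4) by blast
qed

end
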